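(* Let $\alpha\in\mathbb R$. For all $j\in\mathbb Z$, $k\in\mathbb Z_+$, the Haar function $\psi_{j,k}$ is an eigenfunction of $\mathcal D^\alpha$ corresponding to the eigenvalue $2^{j\alpha}$.
   Context: $\mathbb Z_+$ = non-negative integers. The Cantor dyadic group $G$ is the set of sequences $x=(x_k)_{k\in\mathbb Z}$, $x_k\in\{0,1\}$, such that $x_k=0$ for all $k$ below some index depending on $x$, with coordinatewise addition modulo 2, denoted $\oplus$; $\mathbf 0$ is the zero sequence. For $x\ne\mathbf 0$ let $N(x)$ be the least $k$ with $x_k=1$ and put $\|x\|=2^{-N(x)-1}$; $\|\mathbf 0\|=0$. The metric is $d(x,y)=\|x\oplus y\|$; balls are $I_n(x)=\{y: d(x,y)<2^{-n}\}$, $I_n=I_n(\mathbf 0)=\{x: x_k=0\ \forall k<n\}$, $I=I_0$. $dx$ is the Haar measure with $\int_Idx=1$. Let $\lambda(x)=\sum_{j}x_j2^{-j-1}$; restricted to the elements of $G$ that are not eventually equal to 1 (as $k\to+\infty$), $\lambda$ is a bijection onto $[0,\infty)$, and $\lambda^{-1}$ denotes its inverse. The dilation is $(Dx)_k=x_{k+1}$. For $f:G\to\mathbb C$, $j\in\mathbb Z$, $h\ge0$: $f_{j,h}(x)=2^{j/2}f(D^jx\oplus\lambda^{-1}(h))$. The Fourier–Walsh transform is $\widehat f(\xi)=\int_Gf(x)\mathrm w(\xi,x)\,dx$ for $f\in L_1(G)$, where $\mathrm w(t,x)=(-1)^{\sum_{k\in\mathbb Z}t_kx_{-k-1}}$.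 $\varphi=\mathbf 1_I$ and $\psi=2^{-1/2}(\varphi_{1,0}-\varphi_{1,1})$; the $\psi_{j,k}$ ($j\in\mathbb Z$, $k\in\mathbb Z_+$) are the Haar functions. $\tilde S$ is the space of Haar polynomials, i.e. finite linear combinations of the $\psi_{j,k}$; they are locally constant and compactly supported. For $\alpha\in\mathbb R$ put $\mathbb D^\alpha(x)=\|x\|^\alpha$ for $x\neq\mathbf 0$, $\mathbb D^\alpha(\mathbf 0)=1$. The fractional modified Gibbs derivative $\mathcal D^\alpha:\tilde S\to\tilde S$ is defined by $\widehat{\mathcal D^\alpha\phi}=\mathbb D^\alpha\widehat\phi$. *)

theory Defs
  imports "HOL-Analysis.Analysis" "HOL-Library.Z2"
begin

section \<open>The Cantor dyadic group\<close>

typedef dyadic = "{x :: int \<Rightarrow> bit. \<exists>m. \<forall>k<m. x k = 0}"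
  morphisms coord Abs_dyadic
  by (rule exI[of _ "\<lambda>_. 0"]) simp

setup_lifting type_definition_dyadic

lemma dyadic_eq_iff: "x = y \<longleftrightarrow> (\<forall>k. coord x k = coord y k)"
  by transfer auto

lemma coord_zero_below: "\<exists>m. \<forall>k<m. coord x k = 0"
  using coord by auto

text \<open>The group operation \<open>\<oplus>\<close> is written \<open>+\<close>; every element is its own inverse.\<close>

instantiation dyadic :: ab_group_add
begin

lift_definition zero_dyadic :: dyadic is "\<lambda>_. 0" by simp

lift_definition plus_dyadic :: "dyadic \<Rightarrow> dyadic \<Rightarrow> dyadic" is "\<lambda>x y k. x k + y k"
proof -
  fix x y :: "int \<Rightarrow> bit"
  assume "\<exists>m. \<forall>k<m. x k = 0" "\<exists>m. \<forall>k<m. y k = 0"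
  then obtain m n where "\<forall>k<m. x k = 0" "\<forall>k<n. y k = 0" by auto
  then have "\<forall>k<min m n. x k + y k = 0" by simp
  then show "\<exists>m. \<forall>k<m. x k + y k = 0" by blast
qed

definition uminus_dyadic :: "dyadic \<Rightarrow> dyadic" where
  "- x = (x :: dyadic)"

definition minus_dyadic :: "dyadic \<Rightarrow> dyadic \<Rightarrow> dyadic" where
  "x - y = x + (y :: dyadic)"

instance
proof
  fix a b c :: dyadic
  show "a + b + c = a + (b + c)" by transfer (simp only: add.assoc)
  show "a + b = b + a" by transfer (simp only: add.commute)
  show "0 + a = a" by transfer (simp only: add_0)
  show "- a + a = 0" unfolding uminus_dyadic_def by transfer simp
  show "a - b = a + - b" by (simp add: uminus_dyadic_def minus_dyadic_def)
qed

end

lemma coord_zero [simp]: "coord 0 k = 0"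
  by (simp add: zero_dyadic.rep_eq)

lemma coord_plus [simp]: "coord (x + y) k = coord x k + coord y k"
  by (simp add: plus_dyadic.rep_eq)

lemma coord_minus [simp]: "coord (x - y) k = coord x k + coord y k"
  by (simp add: minus_dyadic_def)

definition leading_index :: "dyadic \<Rightarrow> int" where
  "leading_index x = (LEAST k. coord x k = 1)"

lemma leading_index_props:
  assumes "x \<noteq> 0"
  shows "coord x (leading_index x) = 1" "\<And>k. k < leading_index x \<Longrightarrow> coord x k = 0"
proof -
  obtain m where m: "\<forall>k<m. coord x k = 0" using coord_zero_below by blast
  obtain k0 where k0: "coord x k0 = 1" using assms by (auto simp: dyadic_eq_iff)
  have k0m: "m \<le> k0" using m k0 by (metis linorder_not_less zero_neq_one)
  let ?P = "\<lambda>i. coord x (m + int i) = 1"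
  define i where "i = (LEAST i. ?P i)"
  have ex: "?P (nat (k0 - m))" using k0 k0m by simp
  have P: "?P i" unfolding i_def by (rule LeastI[of ?P, OF ex])
  have min: "m + int i \<le> k" if "coord x k = 1" for k
  proof -
    have "m \<le> k" using m that by (metis linorder_not_less zero_neq_one)
    then have "?P (nat (k - m))" using that by simp
    then have "i \<le> nat (k - m)" unfolding i_def by (rule Least_le)
    then show ?thesis using \<open>m \<le> k\<close> by linarith
  qed
  have eq: "leading_index x = m + int i"
    unfolding leading_index_def by (rule Least_equality) (use P min in auto)
  show "coord x (leading_index x) = 1" using P eq by simp
  show "coord x k = 0" if "k < leading_index x" for k
    using min[of k] that eq by force
qed

definition norm_dyadic :: "dyadic \<Rightarrow> real" where
  "norm_dyadic x = (if x = 0 then 0 else 2 powi (- leading_index x - 1))"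

lemma two_powi_less_iff: "(2::real) powi m < 2 powi n \<longleftrightarrow> m < n"
  by (metis less_le_not_le linorder_not_less one_less_numeral_iff power_int_strict_increasing
      power_int_increasing semiring_norm(76) one_le_numeral)

lemma norm_dyadic_less_iff:
  "norm_dyadic x < 2 powi (- n) \<longleftrightarrow> (\<forall>k<n. coord x k = 0)"
proof (cases "x = 0")
  case False
  note L = leading_index_props[OF False]
  have "norm_dyadic x < 2 powi (- n) \<longleftrightarrow> - leading_index x - 1 < - n"
    using False by (simp add: norm_dyadic_def two_powi_less_iff)
  also have "\<dots> \<longleftrightarrow> n \<le> leading_index x" by linarith
  also have "\<dots> \<longleftrightarrow> (\<forall>k<n. coord x k = 0)"
    using L by (metis linorder_not_less order_less_le_trans zero_neq_one)
  finally show ?thesis .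
qed (simp add: norm_dyadic_def)

instantiation dyadic :: metric_space
begin

definition dist_dyadic :: "dyadic \<Rightarrow> dyadic \<Rightarrow> real" where
  "dist_dyadic x y = norm_dyadic (x + y)"

definition uniformity_dyadic :: "(dyadic \<times> dyadic) filter" where
  "uniformity_dyadic = (INF e\<in>{0 <..}. principal {(x, y). dist x y < e})"

definition open_dyadic :: "dyadic set \<Rightarrow> bool" where
  "open_dyadic U \<longleftrightarrow> (\<forall>x\<in>U. eventually (\<lambda>(x', y). x' = x \<longrightarrow> y \<in> U) uniformity)"

instance
proof
  fix x y z :: dyadic
  show "uniformity = (INF e\<in>{0 <..}. principal {(x, y :: dyadic). dist x y < e})"
    by (rule uniformity_dyadic_def)
  show "open U \<longleftrightarrow> (\<forall>x\<in>U. eventually (\<lambda>(x', y). x' = x \<longrightarrow> y \<in> U) uniformity)"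
    for U :: "dyadic set"
    by (rule open_dyadic_def)
  have sum0: "x + y = 0 \<longleftrightarrow> x = y"
    by (metis add_right_imp_eq minus_dyadic_def right_minus_eq)
  show "dist x y = 0 \<longleftrightarrow> x = y"
    by (simp add: dist_dyadic_def norm_dyadic_def sum0)
  show "dist x y \<le> dist x z + dist y z"
  proof (rule ccontr)
    assume *: "\<not> dist x y \<le> dist x z + dist y z"
    have nn: "0 \<le> dist x z" "0 \<le> dist y z" by (auto simp: dist_dyadic_def norm_dyadic_def)
    then have "x + y \<noteq> 0" using * by (auto simp: dist_dyadic_def norm_dyadic_def)
    define n where "n = leading_index (x + y) + 1"
    have d: "dist x y = 2 powi (- n)"
      using \<open>x + y \<noteq> 0\<close> by (simp add: dist_dyadic_def norm_dyadic_def n_def)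
    have "dist x z < 2 powi (- n)" "dist y z < 2 powi (- n)" using * nn d by linarith+
    then have "\<forall>k<n. coord x k + coord z k = 0" "\<forall>k<n. coord y k + coord z k = 0"
      by (simp_all add: dist_dyadic_def norm_dyadic_less_iff)
    then have "\<forall>k<n. coord (x + y) k = 0"
      by (metis coord_plus minus_bit_def right_minus_eq)
    then have "dist x y < 2 powi (- n)" by (simp add: dist_dyadic_def norm_dyadic_less_iff)
    then show False using d by simp
  qed
qed

end


definition dball :: "int \<Rightarrow> dyadic \<Rightarrow> dyadic set" where
  "dball n x = {y. dist x y < 2 powi (- n)}"

abbreviation unit_ball :: "dyadic set" where
  "unit_ball \<equiv> dball 0 0"

lemma dball_iff: "y \<in> dball n x \<longleftrightarrow> (\<forall>k<n. coord y k = coord x k)"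
proof -
  have "(a::bit) + b = 0 \<longleftrightarrow> b = a" for a b by (cases a; cases b) simp_all
  then show ?thesis
    unfolding dball_def dist_dyadic_def norm_dyadic_less_iff coord_plus mem_Collect_eq by blast
qed


section \<open>Haar measure\<close>

text \<open>
  Invariance together with \<open>\<mu> I = 1\<close> forces finiteness on compact sets, and regularity is
  automatic because the group is a locally compact metric space with countable base.
\<close>

definition normalized_haar :: "dyadic measure \<Rightarrow> bool" where
  "normalized_haar \<mu> \<longleftrightarrow>
     sets \<mu> = sets borel \<and>
     (\<forall>a. \<forall>A\<in>sets \<mu>. emeasure \<mu> ((+) a ` A) = emeasure \<mu> A) \<and>
     emeasure \<mu> unit_ball = 1"

definition haar :: "dyadic measure" where
  "haar = (THE \<mu>. normalized_haar \<mu>)"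

subsection \<open>Existence and uniqueness\<close>

lemma open_dball: "open (dball n x)"
  by (simp add: dball_def open_ball[of x, unfolded ball_def])

lemma dball_self [simp]: "x \<in> dball n x"
  by (simp add: dball_iff)

lemma dball_eqI: "y \<in> dball n x \<Longrightarrow> dball n y = dball n x"
  by (auto simp: dball_iff)

definition dballs :: "dyadic set set" where
  "dballs = insert {} (range (case_prod dball))"

lemma dballsI [intro, simp]: "dball n x \<in> dballs"
  unfolding dballs_def by (rule insertI2, rule range_eqI[of _ _ "(n, x)"]) simp

lemma Int_stable_dballs: "Int_stable dballs"
proof (rule Int_stableI)
  have ball: "dball m x \<inter> dball n y \<in> dballs" if "m \<le> n" for m n x y
  proof (cases "dball m x \<inter> dball n y = {}")
    case False
    then obtain z where z: "z \<in> dball m x" "z \<in> dball n y" by auto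
    have "dball n z \<subseteq> dball m z" using that by (auto simp: dball_iff)
    then have "dball m x \<inter> dball n y = dball n z"
      using dball_eqI[OF z(1)] dball_eqI[OF z(2)] by auto
    then show ?thesis by simp
  qed (simp add: dballs_def)
  fix A B assume A: "A \<in> dballs" and B: "B \<in> dballs"
  show "A \<inter> B \<in> dballs"
  proof (cases "A = {} \<or> B = {}")
    case False
    then obtain m n x y where "A = dball m x" "B = dball n y"
      using A B by (auto simp: dballs_def)
    then show ?thesis using ball[of m n x y] ball[of n m y x] by (metis Int_commute linear)
  qed (auto simp: dballs_def)
qed

lemma countable_dballs: "countable dballs"
proof -
  define F :: "int \<times> int set \<Rightarrow> dyadic set"
    where "F = (\<lambda>(n, S). {y. \<forall>k<n. coord y k = of_bool (k \<in> S)})"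
  have "dball n x \<in> F ` (UNIV \<times> {S. finite S})" for n x
  proof -
    obtain m where m: "\<forall>k<m. coord x k = 0" using coord_zero_below by blast
    define S where "S = {k. k < n \<and> coord x k = 1}"
    have "S \<subseteq> {m..<n}" using m by (auto simp: S_def) (metis linorder_not_less zero_neq_one)
    then have "finite S" by (rule finite_subset) simp
    moreover have "dball n x = F (n, S)"
    proof -
      have "(of_bool (k \<in> S) :: bit) = coord x k" if "k < n" for k
        using that by (cases "coord x k") (auto simp: S_def)
      then show ?thesis by (auto simp: F_def dball_iff)
    qed
    ultimately show ?thesis by blast
  qed
  then have "dballs \<subseteq> insert {} (F ` (UNIV \<times> {S. finite S}))" by (auto simp: dballs_def)
  moreover have "countable (insert {} (F ` (UNIV \<times> {S :: int set. finite S})))"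
    by (intro countable_insert countable_image countable_SIGMA countableI_type)
       (rule countable_Collect_finite)
  ultimately show ?thesis by (rule countable_subset)
qed

lemma topological_basis_dballs: "topological_basis dballs"
proof (rule topological_basisI)
  show "open B" if "B \<in> dballs" for B
    using that open_dball by (auto simp: dballs_def)
  fix U :: "dyadic set" and x assume U: "open U" "x \<in> U"
  obtain e where e: "e > 0" "\<And>y. dist y x < e \<Longrightarrow> y \<in> U"
    using U unfolding open_dist by blast
  obtain n :: nat where n: "(1/2) ^ n < e"
    using real_arch_pow_inv[OF e(1), of "1/2"] by auto
  then have "2 powi (- int n) < e" by (simp add: power_int_minus field_simps)
  then have "dball (int n) x \<subseteq> U"
    using e(2) by (auto simp: dball_def dist_commute)
  then show "\<exists>B\<in>dballs. x \<in> B \<and> B \<subseteq> U"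
    using dball_self[of x "int n"] by blast
qed

lemma sets_borel_dyadic: "sets borel = sigma_sets UNIV dballs"
  by (simp add: borel_eq_countable_basis[OF countable_dballs topological_basis_dballs])

lemma dball_borel [measurable]: "dball n x \<in> sets borel"
  using open_dball by (rule borel_open)

lemma measure_eqI_dballs:
  assumes "sets M = sets borel" "sets N = sets borel"
    and M: "\<And>n x. emeasure M (dball n x) = ennreal (2 powi (- n))"
    and N: "\<And>n x. emeasure N (dball n x) = ennreal (2 powi (- n))"
  shows "M = N"
proof (rule measure_eqI_generator_eq[OF Int_stable_dballs, where A = "\<lambda>i. dball (- int i) 0"])
  show "emeasure M X = emeasure N X" if "X \<in> dballs" for X
    using that by (auto simp: dballs_def M N)
  show "(\<Union>i. dball (- int i) 0) = UNIV"
  proof (intro set_eqI iffI UNIV_I)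
    fix x
    obtain m where "\<forall>k<m. coord x k = 0" using coord_zero_below by blast
    then have "x \<in> dball (- int (nat (- m))) 0" by (auto simp: dball_iff)
    then show "x \<in> (\<Union>i. dball (- int i) 0)" by blast
  qed
qed (use assms sets_borel_dyadic in \<open>auto simp: M\<close>)

lemma dyadic_add_self: "a + a = (0 :: dyadic)"
  using minus_dyadic_def[of a a] by simp

lemma translate_dball: "(+) a ` dball n x = dball n (a + x)"
proof -
  have *: "(+) a ` dball n x \<subseteq> dball n (a + x)" for a x by (auto simp: dball_iff)
  have "a + (a + y) = y" for y :: dyadic
    using add.assoc[of a a y] minus_dyadic_def[of a a] by simp
  then have "dball n (a + x) \<subseteq> (+) a ` dball n x"
    using *[of a "a + x"] by (metis image_eqI image_subset_iff subsetI)
  with * show ?thesis by blast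
qed

lemma normalized_haar_dball:
  assumes "normalized_haar M"
  shows "emeasure M (dball n x) = ennreal (2 powi (- n))"
proof -
  have sets: "sets M = sets borel"
    and inv: "\<And>a A. A \<in> sets M \<Longrightarrow> emeasure M ((+) a ` A) = emeasure M A"
    and one: "emeasure M unit_ball = 1"
    using assms by (auto simp: normalized_haar_def)
  define b where "b n = emeasure M (dball n 0)" for n
  have centre: "emeasure M (dball n x) = b n" for n x
    using inv[of "dball n 0" x] by (simp add: sets translate_dball b_def)
  have double: "b n = 2 * b (n + 1)" for n
  proof -
    obtain e where e: "coord e = (\<lambda>k. of_bool (k = n))"
      by (rule exE[of "\<lambda>e. coord e = (\<lambda>k. of_bool (k = n))"])
         (auto intro!: exI[of _ "Abs_dyadic (\<lambda>k. of_bool (k = n))"] Abs_dyadic_inverse exI[of _ n])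
    have le: "k < n + 1 \<longleftrightarrow> k < n \<or> k = n" for k by linarith
    have bit: "a = 0 \<or> a = 1" for a :: bit by (cases a) simp_all
    have U: "dball n 0 = dball (n + 1) 0 \<union> dball (n + 1) e"
    proof (intro set_eqI)
      fix y
      show "y \<in> dball n 0 \<longleftrightarrow> y \<in> dball (n + 1) 0 \<union> dball (n + 1) e"
      proof -
        have "y \<in> dball (n + 1) 0 \<longleftrightarrow> y \<in> dball n 0 \<and> coord y n = 0"
          unfolding dball_iff le by auto
        moreover have "y \<in> dball (n + 1) e \<longleftrightarrow> y \<in> dball n 0 \<and> coord y n = 1"
          unfolding dball_iff le e by auto
        ultimately show ?thesis using bit[of "coord y n"] by blast
      qed
    qed
    have "dball (n + 1) 0 \<inter> dball (n + 1) e = {}"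
      by (auto simp: dball_iff le e)
    then have "b n = emeasure M (dball (n + 1) 0) + emeasure M (dball (n + 1) e)"
      unfolding b_def U by (subst plus_emeasure) (auto simp: sets)
    then show ?thesis by (simp add: centre mult_2)
  qed
  have pw: "2 * (2::real) powi (- m) = 2 powi (- (m - 1))" for m
    using power_int_add_1'[of "2::real" "- m"] by (simp add: algebra_simps)
  have half: "b (n + 1) = ennreal (2 powi (- (n + 1)))" if "b n = ennreal (2 powi (- n))" for n
  proof -
    have "ennreal 2 * b (n + 1) = ennreal 2 * ennreal (2 powi (- (n + 1)))"
      using double[of n] that pw[of "n + 1"] by (simp flip: ennreal_numeral ennreal_mult')
    then show ?thesis by (simp add: ennreal_mult_cancel_left)
  qed
  have "b n = ennreal (2 powi (- n))"
  proof (induction n rule: int_induct[where k = 0])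
    case base then show ?case using one by (simp add: b_def)
  next
    case (step1 i) then show ?case using half by blast
  next
    case (step2 i)
    have "b (i - 1) = ennreal 2 * ennreal (2 powi (- i))"
      using double[of "i - 1"] step2 by simp
    also have "\<dots> = ennreal (2 * 2 powi (- i))" by (rule ennreal_mult'[symmetric]) simp
    also have "\<dots> = ennreal (2 powi (- (i - 1)))" by (simp only: pw)
    finally show ?case .
  qed
  then show ?thesis by (simp add: centre)
qed

text \<open>
  Existence is shown by transporting Lebesgue measure on \<open>[0, \<infinity>)\<close> along binary expansion.
\<close>

lift_definition digits :: "real \<Rightarrow> dyadic" is
  "\<lambda>t k. of_bool (odd \<lfloor>\<bar>t\<bar> * 2 powi (k + 1)\<rfloor>)"
proof -
  fix t :: real
  obtain n :: nat where "\<bar>t\<bar> < 2 ^ n" using real_arch_pow[of 2 "\<bar>t\<bar>"] by auto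
  then have n: "\<bar>t\<bar> * 2 powi (- int n) < 1" by (simp add: power_int_minus field_simps)
  have "\<lfloor>\<bar>t\<bar> * 2 powi (k + 1)\<rfloor> = 0" if "k < - int n" for k
  proof -
    have "(2::real) powi (k + 1) \<le> 2 powi (- int n)" using that by (intro power_int_increasing) auto
    then have "\<bar>t\<bar> * 2 powi (k + 1) \<le> \<bar>t\<bar> * 2 powi (- int n)" by (intro mult_left_mono) auto
    then show ?thesis using n by (auto simp: floor_eq_iff)
  qed
  then show "\<exists>m. \<forall>k<m. (of_bool (odd \<lfloor>\<bar>t\<bar> * 2 powi (k + 1)\<rfloor>) :: bit) = 0"
    by (intro exI[of _ "- int n"]) simp
qed

lemma floor_double: "\<lfloor>2 * (u::real)\<rfloor> = 2 * \<lfloor>u\<rfloor> + of_bool (odd \<lfloor>2 * u\<rfloor>)"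
proof -
  have "\<lfloor>u\<rfloor> = \<lfloor>2 * u\<rfloor> div 2" using floor_divide_real_eq_div[of 2 "2 * u"] by simp
  moreover have "m = 2 * (m div 2) + of_bool (odd m)" for m :: int
    by (cases "odd m") auto
  ultimately show ?thesis by metis
qed

lemma digits_interval:
  "\<exists>q\<ge>0. \<forall>t\<ge>0. digits t \<in> dball n x \<longleftrightarrow> \<lfloor>t * 2 powi n\<rfloor> = q"
proof -
  define u where "u t n = \<lfloor>t * 2 powi n\<rfloor>" for t :: real and n :: int
  have u_step: "u t (n + 1) = 2 * u t n + of_bool (odd (u t (n + 1)))" for t n
    using floor_double[of "t * 2 powi n"] by (simp add: u_def power_int_add mult.commute mult.left_commute)
  have coord_u: "coord (digits t) k = of_bool (odd (u t (k + 1)))" if "t \<ge> 0" for t k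
    using that by (simp add: digits.rep_eq u_def)
  have up: "\<exists>q\<ge>0. \<forall>t\<ge>0. digits t \<in> dball (n + 1) x \<longleftrightarrow> u t (n + 1) = q"
    if hyp: "\<exists>q\<ge>0. \<forall>t\<ge>0. digits t \<in> dball n x \<longleftrightarrow> u t n = q" for n
  proof -
    obtain q where q: "q \<ge> 0" "\<forall>t\<ge>0. digits t \<in> dball n x \<longleftrightarrow> u t n = q"
      using hyp by blast
    have le: "k < n + 1 \<longleftrightarrow> k < n \<or> k = n" for k by linarith
    have "digits t \<in> dball (n + 1) x \<longleftrightarrow> u t (n + 1) = 2 * q + of_bool (coord x n = 1)"
      if t: "t \<ge> 0" for t
    proof -
      have "digits t \<in> dball (n + 1) x \<longleftrightarrow>
          digits t \<in> dball n x \<and> coord (digits t) n = coord x n"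
        unfolding dball_iff le by blast
      also have "\<dots> \<longleftrightarrow> u t n = q \<and> of_bool (odd (u t (n + 1))) = coord x n"
        using q(2)[rule_format, OF t] coord_u[OF t] by simp
      also have "\<dots> \<longleftrightarrow> u t (n + 1) = 2 * q + of_bool (coord x n = 1)"
      proof -
        have eo: "(of_bool P :: bit) = c \<longleftrightarrow> (P \<longleftrightarrow> c = 1)" for P c by (cases c) auto
        have ar: "a = q \<and> (odd b \<longleftrightarrow> R) \<longleftrightarrow> b = 2 * q + of_bool R"
          if "b = 2 * a + of_bool (odd b)" for a b :: int and R
          using that by (cases R; cases "odd b"; simp; presburger)
        show ?thesis unfolding eo by (rule ar[OF u_step])
      qed
      finally show ?thesis .
    qed
    then show ?thesis using q(1)
      by (intro exI[of _ "2 * q + of_bool (coord x n = 1)"]) auto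
  qed
  obtain m where m: "\<forall>k<m. coord x k = 0" using coord_zero_below by blast
  have low: "digits t \<in> dball l x \<longleftrightarrow> u t l = 0" if "t \<ge> 0" "l \<le> m" for t l
  proof
    assume "digits t \<in> dball l x"
    then have "\<forall>k<l. coord (digits t) k = 0" using m that by (auto simp: dball_iff)
    then have ev: "even (u t k)" if "k \<le> l" for k
      using coord_u[OF \<open>t \<ge> 0\<close>, of "k - 1"] that by auto
    obtain i :: nat where i: "t * 2 powi l < 2 ^ i" using real_arch_pow[of 2 "t * 2 powi l"] by auto
    have "u t (l - int i) = 0"
    proof -
      have "t * 2 powi (l - int i) < 1" using i by (simp add: power_int_diff field_simps)
      then show ?thesis using that by (auto simp: u_def floor_eq_iff)
    qed
    moreover have "u t (l - int i) = 0 \<longrightarrow> u t l = 0" for i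
    proof (induction i)
      case (Suc i)
      have "u t (l - int (Suc i) + 1) = 2 * u t (l - int (Suc i))"
        using u_step[of t "l - int (Suc i)"] ev[of "l - int (Suc i) + 1"] by simp
      then show ?case using Suc by simp
    qed simp
    ultimately show "u t l = 0" by blast
  next
    assume z: "u t l = 0"
    have "u t k = 0" if "k \<le> l" for k
    proof -
      have "t * 2 powi k \<le> t * 2 powi l"
        using \<open>t \<ge> 0\<close> that by (intro mult_left_mono power_int_increasing) auto
      moreover have "t * 2 powi l < 1" using z by (auto simp: u_def floor_eq_iff)
      ultimately show ?thesis using \<open>t \<ge> 0\<close> by (auto simp: u_def floor_eq_iff)
    qed
    then show "digits t \<in> dball l x"
      using m that coord_u[OF \<open>t \<ge> 0\<close>] by (auto simp: dball_iff)
  qed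
  have "\<exists>q\<ge>0. \<forall>t\<ge>0. digits t \<in> dball n x \<longleftrightarrow> u t n = q"
  proof (cases "n \<le> m")
    case True
    then show ?thesis using low by (intro exI[of _ 0]) auto
  next
    case False
    then have "m \<le> n" by simp
    then show ?thesis
    proof (induction n rule: int_ge_induct)
      case base
      then show ?case using low
        by (intro exI[of _ 0]) auto
    next
      case (step i)
      then show ?case by (intro up)
    qed
  qed
  then show ?thesis by (simp add: u_def)
qed

lemma digits_vimage:
  "\<exists>a\<ge>0. digits -` dball n x \<inter> {0..} = {a..<a + 2 powi (- n)}"
proof -
  obtain q where q: "q \<ge> 0" "\<And>t. t \<ge> 0 \<Longrightarrow> digits t \<in> dball n x \<longleftrightarrow> \<lfloor>t * 2 powi n\<rfloor> = q"
    using digits_interval[of n x] by blast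
  define c :: real where "c = 2 powi n"
  have c: "c > 0" by (simp add: c_def)
  define a where "a = real_of_int q / c"
  have "a \<ge> 0" using q(1) c by (simp add: a_def)
  have "\<lfloor>t * c\<rfloor> = q \<longleftrightarrow> t \<in> {a..<a + 1 / c}" for t
    using c by (auto simp: floor_eq_iff a_def field_simps)
  then have "digits -` dball n x \<inter> {0..} = {a..<a + 1 / c}"
    using q(2) \<open>a \<ge> 0\<close> by (auto simp: c_def[symmetric])
  then show ?thesis using \<open>a \<ge> 0\<close> by (auto simp: c_def power_int_minus field_simps)
qed

definition haar0 :: "dyadic measure" where
  "haar0 = distr (restrict_space lborel {0..}) borel digits"

lemma digits_measurable: "digits \<in> measurable (restrict_space lborel {0..}) borel"
proof -
  have "digits \<in> measurable (restrict_space lborel {0..}) (sigma UNIV dballs)"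
  proof (rule measurable_measure_of)
    fix A assume "A \<in> dballs"
    then show "digits -` A \<inter> space (restrict_space lborel {0..}) \<in> sets (restrict_space lborel {0..})"
    proof (cases "A = {}")
      case False
      then obtain n x where A: "A = dball n x" using \<open>A \<in> dballs\<close> by (auto simp: dballs_def)
      obtain a where a: "a \<ge> 0" "digits -` dball n x \<inter> {0..} = {a..<a + 2 powi (- n)}"
        using digits_vimage by blast
      then show ?thesis
        by (auto simp: A space_restrict_space sets_restrict_space_iff)
    qed simp
  qed auto
  then show ?thesis
    by (simp add: borel_eq_countable_basis[OF countable_dballs topological_basis_dballs])
qed

lemma haar0_dball: "emeasure haar0 (dball n x) = ennreal (2 powi (- n))"
proof -
  obtain a where a: "a \<ge> 0" "digits -` dball n x \<inter> {0..} = {a..<a + 2 powi (- n)}"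
    using digits_vimage by blast
  have "emeasure haar0 (dball n x) = emeasure (restrict_space lborel {0..}) {a..<a + 2 powi (- n)}"
    unfolding haar0_def using a(2)
    by (subst emeasure_distr[OF digits_measurable dball_borel]) (simp add: space_restrict_space)
  also have "\<dots> = ennreal (2 powi (- n))"
    using a(1) by (subst emeasure_restrict_space) auto
  finally show ?thesis .
qed

lemma translate_measurable: "(+) (a :: dyadic) \<in> borel \<rightarrow>\<^sub>M borel"
proof -
  have "isCont ((+) a) x" for x :: dyadic
    unfolding isCont_def
  proof (rule metric_LIM_I)
    fix r :: real assume "r > 0"
    have "a + y + (a + x) = (a + a) + (y + x)" for y by (simp only: ac_simps)
    then have "dist (a + y) (a + x) = dist y x" for y
      by (simp only: dist_dyadic_def dyadic_add_self add_0)
    then show "\<exists>s>0. \<forall>y. y \<noteq> x \<and> dist y x < s \<longrightarrow> dist (a + y) (a + x) < r"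
      using \<open>r > 0\<close> by auto
  qed
  then show ?thesis
    by (intro borel_measurable_continuous_onI continuous_at_imp_continuous_on) auto
qed

lemma normalized_haar0: "normalized_haar haar0"
  unfolding normalized_haar_def
proof (intro conjI allI ballI)
  show sets: "sets haar0 = sets borel" by (simp add: haar0_def)
  show "emeasure haar0 unit_ball = 1" by (simp add: haar0_dball)
  fix a A assume A: "A \<in> sets haar0"
  have cancel: "a + (a + y) = y" for y :: dyadic
    by (simp add: dyadic_add_self flip: add.assoc)
  have vimage: "(+) a -` B = (+) a ` B" for B
    by (metis (no_types, lifting) cancel image_eqI image_iff vimageE vimageI set_eqI)
  have meas: "(+) a \<in> haar0 \<rightarrow>\<^sub>M borel"
    using translate_measurable sets by (simp cong: measurable_cong_sets)
  have "distr haar0 borel ((+) a) = haar0"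
    by (rule measure_eqI_dballs)
       (use meas sets sets_eq_imp_space_eq[OF sets] in
         \<open>auto simp: emeasure_distr vimage translate_dball haar0_dball\<close>)
  then have "emeasure haar0 A = emeasure (distr haar0 borel ((+) a)) A" by simp
  also have "\<dots> = emeasure haar0 ((+) a ` A)"
    using A meas sets sets_eq_imp_space_eq[OF sets] by (simp add: emeasure_distr vimage)
  finally show "emeasure haar0 ((+) a ` A) = emeasure haar0 A" by simp
qed

theorem normalized_haar_ex1: "\<exists>!\<mu>. normalized_haar \<mu>"
proof (rule ex1I[of normalized_haar, OF normalized_haar0])
  fix \<mu> assume "normalized_haar \<mu>"
  then show "\<mu> = haar0"
    using normalized_haar_dball haar0_dball
    by (intro measure_eqI_dballs) (auto simp: normalized_haar_def haar0_def)
qed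

lemma normalized_haar_haar: "normalized_haar haar"
  unfolding haar_def by (rule theI'[of normalized_haar, OF normalized_haar_ex1])


section \<open>Dilations and translations\<close>

definition lam :: "dyadic \<Rightarrow> real" where
  "lam x = (\<Sum>\<^sub>\<infinity>j. of_bit (coord x j) * 2 powi (- j - 1))"

text \<open>Used at nonnegative arguments only.\<close>

definition lam_inv :: "real \<Rightarrow> dyadic" where
  "lam_inv = inv_into {x. \<not> (\<exists>m. \<forall>k\<ge>m. coord x k = 1)} lam"

lift_definition dilation :: "dyadic \<Rightarrow> dyadic" is "\<lambda>x k. x (k + 1)"
proof -
  fix x :: "int \<Rightarrow> bit"
  assume "\<exists>m. \<forall>k<m. x k = 0"
  then obtain m where "\<forall>k<m. x k = 0" ..
  then show "\<exists>m. \<forall>k<m. x (k + 1) = 0" by (intro exI[of _ "m - 1"]) simp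
qed

text \<open>Integer powers of the bijection \<open>dilation\<close>; see \<open>coord_dilation_pow\<close> below.\<close>

definition dilation_pow :: "int \<Rightarrow> dyadic \<Rightarrow> dyadic" where
  "dilation_pow j = (if 0 \<le> j then dilation ^^ nat j else inv dilation ^^ nat (- j))"

lemma coord_dilation_pow: "coord (dilation_pow j x) k = coord x (k + j)"
proof -
  have pos: "coord ((dilation ^^ n) x) k = coord x (k + int n)" for n x k
    by (induction n arbitrary: k) (simp_all add: dilation.rep_eq algebra_simps)
  have inv: "coord (inv dilation x) k = coord x (k - 1)" for x k
  proof -
    obtain m where "\<forall>k<m. coord x k = 0" using coord_zero_below by blast
    then have "\<exists>m. \<forall>k<m. coord x (k - 1) = 0" by (intro exI[of _ m]) simp
    then have "coord (Abs_dyadic (\<lambda>k. coord x (k - 1))) = (\<lambda>k. coord x (k - 1))"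
      by (intro Abs_dyadic_inverse) simp
    then have "dilation (Abs_dyadic (\<lambda>k. coord x (k - 1))) = x"
      by (simp add: dyadic_eq_iff dilation.rep_eq)
    then have "dilation (inv dilation x) = x" by (metis f_inv_into_f rangeI)
    then show ?thesis using dilation.rep_eq[of "inv dilation x"] by (metis diff_add_cancel)
  qed
  have neg: "coord ((inv dilation ^^ n) x) k = coord x (k - int n)" for n x k
    by (induction n arbitrary: k) (simp_all add: inv algebra_simps)
  show ?thesis by (simp add: dilation_pow_def pos neg)
qed

definition dilate_translate :: "(dyadic \<Rightarrow> complex) \<Rightarrow> int \<Rightarrow> real \<Rightarrow> dyadic \<Rightarrow> complex" where
  "dilate_translate f j h x =
     complex_of_real (2 powr (of_int j / 2)) * f (dilation_pow j x + lam_inv h)"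


section \<open>Fourier--Walsh transform\<close>

text \<open>
  The exponent is \<open>\<Sum>k. t\<^sub>k x\<^bsub>-k-1\<^esub>\<close>; only finitely many terms are nonzero, so
  counting them is the sum.
\<close>

definition walsh :: "dyadic \<Rightarrow> dyadic \<Rightarrow> complex" where
  "walsh t x = (- 1) ^ card {k. coord t k * coord x (- k - 1) = 1}"

definition fourier_walsh :: "(dyadic \<Rightarrow> complex) \<Rightarrow> dyadic \<Rightarrow> complex" where
  "fourier_walsh f \<xi> = (\<integral>x. f x * walsh \<xi> x \<partial>haar)"


section \<open>Haar functions and the modified Gibbs derivative\<close>

definition scaling_fun :: "dyadic \<Rightarrow> complex" where
  "scaling_fun = indicator unit_ball"

definition haar_wavelet :: "dyadic \<Rightarrow> complex" where
  "haar_wavelet x = complex_of_real (2 powr (- 1 / 2)) *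
     (dilate_translate scaling_fun 1 0 x - dilate_translate scaling_fun 1 1 x)"

definition haar_fun :: "int \<Rightarrow> nat \<Rightarrow> dyadic \<Rightarrow> complex" where
  "haar_fun j k = dilate_translate haar_wavelet j (real k)"

definition haar_polys :: "(dyadic \<Rightarrow> complex) set" where
  "haar_polys = {f. \<exists>A c. finite A \<and> f = (\<lambda>x. \<Sum>(j, k)\<in>A. c j k * haar_fun j k x)}"

definition gibbs_symbol :: "real \<Rightarrow> dyadic \<Rightarrow> real" where
  "gibbs_symbol \<alpha> x = (if x = 0 then 1 else norm_dyadic x powr \<alpha>)"

text \<open>
  The description operator picks the function in the space of Haar polynomials with the prescribed
  transform (the Fourier--Walsh transform is injective on that space); nothing is claimed for
  arguments that are not Haar polynomials.
\<close>

definition gibbs_derivative :: "real \<Rightarrow> (dyadic \<Rightarrow> complex) \<Rightarrow> (dyadic \<Rightarrow> complex)" where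
  "gibbs_derivative \<alpha> f =
     (THE g. g \<in> haar_polys \<and>
        (\<forall>\<xi>. fourier_walsh g \<xi> = complex_of_real (gibbs_symbol \<alpha> \<xi>) * fourier_walsh f \<xi>))"

definition eigenfunction ::
  "((dyadic \<Rightarrow> complex) \<Rightarrow> (dyadic \<Rightarrow> complex)) \<Rightarrow> complex \<Rightarrow> (dyadic \<Rightarrow> complex) \<Rightarrow> bool" where
  "eigenfunction T c f \<longleftrightarrow> f \<in> haar_polys \<and> f \<noteq> (\<lambda>_. 0) \<and> T f = (\<lambda>x. c * f x)"

end

(*
  Up to a nonzero factor, the Haar function with indices j and k is the indicator of a ball of
  radius 2^{-j} times the Walsh character of the element whose only nonzero coordinate has index
  -j-1; the position of the ball plays no role. A character is integrated to zero over a ball on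
  which it is not constant, so the transform of the Haar function lives on {||xi|| = 2^j}, where
  the symbol is the constant 2^{j alpha}. Since the derivative is given by a description operator,
  the transform also has to be injective on Haar polynomials: if the transform of g vanishes,
  halving balls shows that g has integral zero over every small ball, and g is locally constant.
*)
theory Submission
  imports Defs
begin

text \<open>These elements serve as the value \<open>lam_inv 1\<close>, as translations flipping one
  digit, and as characters reading one digit.\<close>

lift_definition dyadic_unit :: "int \<Rightarrow> dyadic" is "\<lambda>k i. of_bool (i = k)"
  by (rule_tac x = "int" in exI) auto

lemma coord_dyadic_unit [simp]: "coord (dyadic_unit k) i = of_bool (i = k)"
  by (simp add: dyadic_unit.rep_eq)

lemma bit_eq_0_or_1: "(a :: bit) = 0 \<or> a = 1"
  by (cases a) simp_all

section \<open>The bijection onto the half-line\<close>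

text \<open>The geometric series after the shift i -> m + i. It majorises the series of
  \<open>lam x\<close> when x vanishes below m.\<close>

lemma has_sum_two_powi_tail:
  "((\<lambda>j. (2::real) powi (- j - 1)) has_sum 2 powi (- m)) {m..}"
proof -
  have eq: "(\<lambda>i. (2::real) powi (- (m + int i) - 1)) = (\<lambda>i. 2 powi (- m - 1) * (1/2) ^ i)"
  proof
    fix i
    have "- (m + int i) - 1 = (- m - 1) + - int i" by simp
    moreover have "(2::real) powi (- int i) = (1/2) ^ i"
      by (simp add: power_int_minus power_divide field_simps)
    ultimately show "(2::real) powi (- (m + int i) - 1) = 2 powi (- m - 1) * (1/2) ^ i"
      by (simp only: power_int_add zero_neq_numeral[symmetric] simp_thms)
  qed
  have "(\<lambda>i. (1/2::real) ^ i) sums 2" using geometric_sums[of "1/2::real"] by simp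
  then have "(\<lambda>i. (2::real) powi (- m - 1) * (1/2) ^ i) sums (2 powi (- m - 1) * 2)"
    by (rule sums_mult)
  then have "((\<lambda>i. (2::real) powi (- (m + int i) - 1)) has_sum (2 powi (- m - 1) * 2)) UNIV"
    unfolding eq by (rule sums_nonneg_imp_has_sum) simp
  moreover have "(2::real) powi (- m - 1) * 2 = 2 powi (- m)"
    by (simp add: power_int_diff)
  ultimately have "((\<lambda>j. (2::real) powi (- j - 1)) \<circ> (\<lambda>i. m + int i) has_sum 2 powi (- m)) UNIV"
    by (simp add: o_def)
  moreover have "range (\<lambda>i. m + int i) = {m..}"
    by (auto simp: image_iff) (metis add.commute diff_add_cancel nonneg_int_cases diff_ge_0_iff_ge)
  moreover have "inj (\<lambda>i. m + int i)" by (simp add: inj_def)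
  ultimately show ?thesis by (metis has_sum_reindex)
qed

text \<open>An infinite sum has the default value 0 when it does not converge, so any use of
  \<open>lam\<close> rests on this.\<close>

lemma lam_summable: "(\<lambda>j. of_bit (coord x j) * (2::real) powi (- j - 1)) summable_on UNIV"
proof -
  obtain m where m: "\<forall>k<m. coord x k = 0" using coord_zero_below by blast
  have "(\<lambda>j. of_bit (coord x j) * (2::real) powi (- j - 1)) summable_on {m..}"
  proof (rule summable_on_comparison_test)
    show "(\<lambda>j. (2::real) powi (- j - 1)) summable_on {m..}"
      using has_sum_two_powi_tail by (rule has_sum_imp_summable)
    show "of_bit (coord x j) * (2::real) powi (- j - 1) \<le> 2 powi (- j - 1)" for j
      by (cases "coord x j") auto
  qed auto
  then show ?thesis
    by (rule summable_on_cong_neutral[THEN iffD1, rotated -1]) (use m in auto)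
qed

lemma lam_has_sum: "((\<lambda>j. of_bit (coord x j) * (2::real) powi (- j - 1)) has_sum lam x) UNIV"
  unfolding lam_def using lam_summable by (rule has_sum_infsum)

lemma sum_le_lam:
  "finite F \<Longrightarrow> (\<Sum>j\<in>F. of_bit (coord x j) * (2::real) powi (- j - 1)) \<le> lam x"
  unfolding lam_def by (rule finite_sum_le_infsum[OF lam_summable]) auto

lemma lam_dyadic_unit: "lam (dyadic_unit k) = 2 powi (- k - 1)"
proof -
  have "((\<lambda>j. of_bit (coord (dyadic_unit k) j) * (2::real) powi (- j - 1)) has_sum
      (\<Sum>j\<in>{k}. of_bit (coord (dyadic_unit k) j) * (2::real) powi (- j - 1))) UNIV"
    by (rule has_sum_cong_neutral[THEN iffD1, OF _ _ _ has_sum_finite[of "{k}"]]) auto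
  from has_sum_unique[OF lam_has_sum this] show ?thesis by simp
qed

lemma lam_eq_0_iff: "lam x = 0 \<longleftrightarrow> x = 0"
proof
  assume 0: "lam x = 0"
  show "x = 0"
  proof (rule ccontr)
    assume "x \<noteq> 0"
    then obtain k where "coord x k = 1" using leading_index_props(1) by blast
    then have "(2::real) powi (- k - 1) \<le> lam x" using sum_le_lam[of "{k}" x] by simp
    moreover have "(2::real) powi (- k - 1) > 0" by simp
    ultimately show False using 0 by linarith
  qed
qed (simp add: lam_def)

text \<open>Filling the gap at j adds 2^{-j-1} > 0 to \<open>lam x\<close>, and the result is still
  bounded by the sequence of all ones from index 0 on, whose value is 1.\<close>

lemma lam_less_1:
  assumes x: "\<forall>k<0. coord x k = 0" and j: "j \<ge> 0" "coord x j = 0"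
  shows "lam x < 1"
proof -
  let ?f = "\<lambda>i. of_bit (coord x i) * (2::real) powi (- i - 1)"
  let ?e = "\<lambda>i. of_bit (coord (dyadic_unit j) i) * (2::real) powi (- i - 1)"
  have "((\<lambda>i. ?f i + ?e i) has_sum (lam x + lam (dyadic_unit j))) UNIV"
    by (intro has_sum_add lam_has_sum)
  moreover have "((\<lambda>i. if i \<ge> 0 then (2::real) powi (- i - 1) else 0) has_sum 1) UNIV"
    by (rule has_sum_cong_neutral[THEN iffD1, OF _ _ _ has_sum_two_powi_tail[of 0, simplified]]) auto
  ultimately have "lam x + lam (dyadic_unit j) \<le> 1"
  proof (rule has_sum_mono)
    fix i
    show "?f i + ?e i \<le> (if i \<ge> 0 then (2::real) powi (- i - 1) else 0)"
      using x j by (cases "coord x i") auto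
  qed
  moreover have "lam (dyadic_unit j) > 0" by (simp add: lam_dyadic_unit)
  ultimately show ?thesis by linarith
qed

text \<open>A digit 1 below index -1 alone contributes at least 2. Without the digit at -1 the value
  is below 1, since a sequence that is not eventually 1 has a gap. With it, a further digit would
  push the value above 1.\<close>

lemma lam_eq_1D:
  assumes lam: "lam x = 1" and fin: "\<not> (\<exists>m. \<forall>k\<ge>m. coord x k = 1)"
  shows "x = dyadic_unit (- 1)"
proof -
  have low: "coord x k = 0" if "k < - 1" for k
  proof (rule ccontr)
    assume "coord x k \<noteq> 0"
    then have "(2::real) powi (- k - 1) \<le> lam x" using sum_le_lam[of "{k}" x] by simp
    moreover have "(2::real) powi 0 < 2 powi (- k - 1)"
      using that by (simp only: two_powi_less_iff)
    ultimately show False using lam by simp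
  qed
  have one: "coord x (- 1) = 1"
  proof (rule ccontr)
    assume "coord x (- 1) \<noteq> 1"
    then have "coord x (- 1) = 0" using bit_eq_0_or_1 by blast
    moreover have "k < 0 \<longleftrightarrow> k < - 1 \<or> k = - 1" for k :: int by linarith
    ultimately have "\<forall>k<0. coord x k = 0" using low by auto
    moreover obtain j where "j \<ge> 0" "coord x j = 0" using fin bit_eq_0_or_1 by blast
    ultimately show False using lam_less_1 lam by fastforce
  qed
  have "coord x k = 0" if "k \<noteq> - 1" for k
  proof (rule ccontr)
    assume "coord x k \<noteq> 0"
    then have "1 + (2::real) powi (- k - 1) \<le> lam x"
      using sum_le_lam[of "{- 1, k}" x] one that by simp
    moreover have "(2::real) powi (- k - 1) > 0" by simp
    ultimately show False using lam by linarith
  qed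
  then show ?thesis using one by (auto simp: dyadic_eq_iff)
qed

text \<open>Only the shifts by 0 and 1 are evaluated, because they define the wavelet. As
  \<open>lam_inv\<close> is a choice of preimage, its value follows from uniqueness of the
  preimage.\<close>

lemma lam_inv_0: "lam_inv 0 = 0"
  unfolding lam_inv_def inv_into_def by (rule some_equality) (auto simp: lam_eq_0_iff)

lemma lam_inv_1: "lam_inv 1 = dyadic_unit (- 1)"
  unfolding lam_inv_def inv_into_def
proof (rule some_equality, intro conjI)
  have "\<not> (\<forall>k\<ge>m. coord (dyadic_unit (- 1)) k = 1)" for m
    by (auto intro!: exI[of _ "max m 0"])
  then show "dyadic_unit (- 1) \<in> {x. \<not> (\<exists>m. \<forall>k\<ge>m. coord x k = 1)}" by blast
next
  show "lam (dyadic_unit (- 1)) = 1" by (simp add: lam_dyadic_unit)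
  show "x = dyadic_unit (- 1)" if "x \<in> {x. \<not> (\<exists>m. \<forall>k\<ge>m. coord x k = 1)} \<and> lam x = 1" for x
    using that lam_eq_1D by blast
qed

section \<open>Walsh characters\<close>

text \<open>The zeros of t bound k from below, and those of x bound it from above through -k-1.
  Finiteness matters because \<open>card\<close> is 0 on infinite sets.\<close>

lemma finite_walsh_support: "finite {k. coord t k * coord x (- k - 1) = 1}"
proof -
  obtain m where m: "\<forall>k<m. coord t k = 0" using coord_zero_below by blast
  obtain n where n: "\<forall>k<n. coord x k = 0" using coord_zero_below by blast
  have "{k. coord t k * coord x (- k - 1) = 1} \<subseteq> {m..- n - 1}"
  proof
    fix k assume "k \<in> {k. coord t k * coord x (- k - 1) = 1}"
    then have "coord t k \<noteq> 0" "coord x (- k - 1) \<noteq> 0" by auto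
    then have "\<not> k < m" "\<not> - k - 1 < n" using m n by blast+
    then show "k \<in> {m..- n - 1}" by auto
  qed
  then show ?thesis by (rule finite_subset) simp
qed

text \<open>Writing several characters as products over one common finite index set reduces
  multiplicativity to a check on single digits.\<close>

lemma walsh_prod:
  assumes "finite F" "{k. coord t k * coord x (- k - 1) = 1} \<subseteq> F"
  shows "walsh t x = (\<Prod>k\<in>F. if coord t k * coord x (- k - 1) = 1 then - 1 else 1)"
proof -
  have "(\<Prod>k\<in>F. if coord t k * coord x (- k - 1) = 1 then - 1 else 1 :: complex)
      = (- 1) ^ card (F \<inter> {k. coord t k * coord x (- k - 1) = 1})"
    using assms(1) by (simp add: prod.If_cases)
  moreover have "F \<inter> {k. coord t k * coord x (- k - 1) = 1} = {k. coord t k * coord x (- k - 1) = 1}"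
    using assms(2) by blast
  ultimately show ?thesis by (simp add: walsh_def)
qed

text \<open>The involution k -> -k-1 exchanges the two supports.\<close>

lemma walsh_commute: "walsh t x = walsh x t"
proof -
  have "{k. coord x k * coord t (- k - 1) = 1} = (\<lambda>k. - k - 1) ` {k. coord t k * coord x (- k - 1) = 1}"
    by (force simp: mult.commute image_iff)
  moreover have "inj_on (\<lambda>k::int. - k - 1) A" for A by (simp add: inj_on_def)
  ultimately show ?thesis by (simp add: walsh_def card_image)
qed

lemma walsh_add_left: "walsh (s + t) x = walsh s x * walsh t x"
proof -
  let ?S = "\<lambda>t. {k. coord t k * coord x (- k - 1) = 1}"
  define F where "F = ?S s \<union> ?S t \<union> ?S (s + t)"
  have F: "finite F" "?S s \<subseteq> F" "?S t \<subseteq> F" "?S (s + t) \<subseteq> F"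
    unfolding F_def by (intro finite_UnI finite_walsh_support) blast+
  have "(if (a + b) * c = 1 then - 1 else 1) =
      (if a * c = 1 then - 1 else 1) * (if b * c = 1 then - 1 else (1::complex))" for a b c :: bit
    by (cases a; cases b; cases c) auto
  then show ?thesis
    unfolding walsh_prod[OF F(1,2)] walsh_prod[OF F(1,3)] walsh_prod[OF F(1,4)]
      prod.distrib[symmetric] by (simp only: coord_plus)
qed

lemma walsh_add_right: "walsh t (x + y) = walsh t x * walsh t y"
  by (metis walsh_add_left walsh_commute)

lemma walsh_dyadic_unit: "walsh (dyadic_unit k) x = (if coord x (- k - 1) = 1 then - 1 else 1)"
proof -
  have "{i. coord (dyadic_unit k) i * coord x (- i - 1) = 1} = (if coord x (- k - 1) = 1 then {k} else {})"
    by auto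
  then show ?thesis by (simp add: walsh_def)
qed

lemma walsh_zero_left [simp]: "walsh 0 x = 1"
  by (simp add: walsh_def)

lemma norm_walsh [simp]: "norm (walsh t x) = 1"
  by (simp add: walsh_def norm_power)

text \<open>If t vanishes below m, the character reads only digits of x with index below -m, so one
  radius serves all points.\<close>

lemma walsh_locally_constant: "\<exists>n. \<forall>x. \<forall>y\<in>dball n x. walsh t y = walsh t x"
proof -
  obtain m where m: "\<forall>k<m. coord t k = 0" using coord_zero_below by blast
  have "walsh t y = walsh t x" if "y \<in> dball (- m) x" for x y
  proof -
    have "coord t k * coord y (- k - 1) = coord t k * coord x (- k - 1)" for k
      using m that by (cases "k < m") (auto simp: dball_iff)
    then show ?thesis by (simp add: walsh_def)
  qed
  then show ?thesis by blast
qed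

section \<open>Integration against Haar measure\<close>

lemma sets_haar [measurable_cong]: "sets haar = sets borel"
  using normalized_haar_haar by (simp add: normalized_haar_def)

lemma emeasure_haar_dball: "emeasure haar (dball n x) = ennreal (2 powi (- n))"
  using normalized_haar_dball normalized_haar_haar by blast

lemma borel_measurable_locally_constant:
  fixes f :: "dyadic \<Rightarrow> 'b :: metric_space"
  assumes "\<forall>x. \<forall>y\<in>dball n x. f y = f x"
  shows "f \<in> borel_measurable borel"
proof -
  have "isCont f x" for x
    unfolding isCont_def
  proof (rule metric_LIM_I)
    fix r :: real assume "r > 0"
    then show "\<exists>s>0. \<forall>y. y \<noteq> x \<and> dist y x < s \<longrightarrow> dist (f y) (f x) < r"
      using assms by (intro exI[of _ "2 powi (- n)"]) (auto simp: dball_def dist_commute)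
  qed
  then show ?thesis
    by (intro borel_measurable_continuous_onI continuous_at_imp_continuous_on) auto
qed

lemma walsh_borel [measurable]: "walsh t \<in> borel_measurable borel"
  using walsh_locally_constant borel_measurable_locally_constant by blast

lemma integrable_mult_walsh:
  assumes "integrable haar g"
  shows "integrable haar (\<lambda>x. g x * walsh t x)"
proof (rule Bochner_Integration.integrable_bound[OF assms])
  show "(\<lambda>x. g x * walsh t x) \<in> borel_measurable haar"
    using borel_measurable_integrable[OF assms] by measurable
qed (simp add: norm_mult)

text \<open>The image of Haar measure under a translation gives every ball the same mass as before,
  and a measure is determined by these masses.\<close>

lemma integral_haar_translate:
  fixes f :: "dyadic \<Rightarrow> complex"
  assumes "f \<in> borel_measurable borel"
  shows "(\<integral>x. f (a + x) \<partial>haar) = (\<integral>x. f x \<partial>haar)"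
proof -
  have meas: "(+) a \<in> haar \<rightarrow>\<^sub>M borel"
    using translate_measurable sets_haar by (simp cong: measurable_cong_sets)
  have cancel: "a + (a + y) = y" for y :: dyadic
    by (simp add: dyadic_add_self flip: add.assoc)
  have vimage: "(+) a -` B = (+) a ` B" for B
    by (metis (no_types, lifting) cancel image_eqI image_iff vimageE vimageI set_eqI)
  have "distr haar borel ((+) a) = haar"
    by (rule measure_eqI_dballs)
       (use meas sets_haar sets_eq_imp_space_eq[OF sets_haar] in
         \<open>auto simp: emeasure_distr vimage translate_dball emeasure_haar_dball\<close>)
  then show ?thesis using integral_distr[OF meas assms] by simp
qed

lemma integral_walsh_dball_eq_0:
  assumes "coord t k = 1" "k < - n"
  shows "(\<integral>x. indicator (dball n b) x * walsh t x \<partial>haar) = 0"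
proof -
  \<comment> \<open>Translation by \<open>?e\<close> preserves the ball and flips the sign of the character.\<close>
  let ?e = "dyadic_unit (- k - 1)"
  let ?f = "\<lambda>x. indicator (dball n b) x * walsh t x"
  \<comment> \<open>From k < -n the flipped index -k-1 is at least n, whereas membership in the ball
    depends only on digits below n.\<close>
  have "coord (?e + x) i = coord x i" if "i < n" for i x
    using assms(2) that by simp
  then have "?e + x \<in> dball n b \<longleftrightarrow> x \<in> dball n b" for x
    by (simp add: dball_iff del: coord_plus)
  moreover have "walsh t ?e = - 1"
    using assms(1) by (subst walsh_commute) (simp add: walsh_dyadic_unit)
  ultimately have "?f (?e + x) = - ?f x" for x
    by (simp add: indicator_def walsh_add_right)
  moreover have "(\<integral>x. ?f (?e + x) \<partial>haar) = (\<integral>x. ?f x \<partial>haar)"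
    by (rule integral_haar_translate) measurable
  ultimately have "- (\<integral>x. ?f x \<partial>haar) = (\<integral>x. ?f x \<partial>haar)"
    by (simp only: Bochner_Integration.integral_minus)
  moreover have "z = 0" if "- z = z" for z :: complex
    using that by (simp add: complex_eq_iff)
  ultimately show ?thesis by blast
qed

section \<open>Injectivity of the Fourier--Walsh transform\<close>

text \<open>The properties of Haar polynomials that injectivity uses, in a form that passes to
  linear combinations: integrability, bounded support, and local constancy with a radius uniform in
  the point.\<close>

definition test_fun :: "(dyadic \<Rightarrow> complex) \<Rightarrow> bool" where
  "test_fun g \<longleftrightarrow> integrable haar g \<and> (\<exists>m. \<forall>x. x \<notin> dball m 0 \<longrightarrow> g x = 0) \<and>
     (\<exists>n. \<forall>x. \<forall>y\<in>dball n x. g y = g x)"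

lemma dball_antimono: "m \<le> n \<Longrightarrow> dball n x \<subseteq> dball m x"
  by (auto simp: dball_iff)

lemma test_fun_add:
  assumes "test_fun f" "test_fun g"
  shows "test_fun (\<lambda>x. f x + g x)"
proof -
  obtain m n m' n' where f: "\<forall>x. x \<notin> dball m 0 \<longrightarrow> f x = 0" "\<forall>x. \<forall>y\<in>dball n x. f y = f x"
    and g: "\<forall>x. x \<notin> dball m' 0 \<longrightarrow> g x = 0" "\<forall>x. \<forall>y\<in>dball n' x. g y = g x"
    using assms unfolding test_fun_def by metis
  have "\<forall>x. x \<notin> dball (min m m') 0 \<longrightarrow> f x + g x = 0"
    using f(1) g(1) dball_antimono[of "min m m'" m] dball_antimono[of "min m m'" m'] by force
  moreover have "\<forall>x. \<forall>y\<in>dball (max n n') x. f y + g y = f x + g x"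
    using f(2) g(2) dball_antimono[of n "max n n'"] dball_antimono[of n' "max n n'"]
    by (metis max.cobounded1 max.cobounded2 subsetD)
  ultimately show ?thesis using assms unfolding test_fun_def by blast
qed

lemma test_fun_cmult: "test_fun f \<Longrightarrow> test_fun (\<lambda>x. c * f x)"
  unfolding test_fun_def by (metis integrable_mult_right mult_zero_right)

lemma test_fun_zero: "test_fun (\<lambda>x. 0)"
  by (simp add: test_fun_def)

lemma test_fun_sum: "(\<And>i. i \<in> A \<Longrightarrow> test_fun (f i)) \<Longrightarrow> test_fun (\<lambda>x. \<Sum>i\<in>A. f i x)"
  by (induction A rule: infinite_finite_induct) (simp_all add: test_fun_zero test_fun_add)

lemma test_fun_indicator_walsh: "test_fun (\<lambda>x. indicator (dball n b) x * walsh t x)"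
  unfolding test_fun_def
proof (intro conjI)
  have "integrable haar (indicator (dball n b) :: dyadic \<Rightarrow> complex)"
    using integrable_of_real[OF integrable_real_indicator, of "dball n b" haar, where 'a = complex]
    by (simp add: emeasure_haar_dball sets_haar of_real_indicator)
  then show "integrable haar (\<lambda>x. indicator (dball n b) x * walsh t x)"
    by (rule integrable_mult_walsh)
  \<comment> \<open>Below \<open>min m n\<close> every point of the ball shares the zero digits of
    b.\<close>
  obtain m where m: "\<forall>k<m. coord b k = 0" using coord_zero_below by blast
  then have "x \<notin> dball n b" if "x \<notin> dball (min m n) 0" for x
    using that by (auto simp: dball_iff)
  then show "\<exists>m. \<forall>x. x \<notin> dball m 0 \<longrightarrow> indicator (dball n b) x * walsh t x = 0"
    by (metis indicator_simps(2) mult_zero_left)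
  obtain l where l: "\<forall>x. \<forall>y\<in>dball l x. walsh t y = walsh t x" using walsh_locally_constant by blast
  have "indicator (dball n b) y * walsh t y = indicator (dball n b) x * walsh t x"
    if "y \<in> dball (max l n) x" for x y
  proof -
    have "y \<in> dball l x" "y \<in> dball n x"
      using that dball_antimono[of l "max l n"] dball_antimono[of n "max l n"] by auto
    then show ?thesis using l by (auto simp: indicator_def dball_iff)
  qed
  then show "\<exists>l. \<forall>x. \<forall>y\<in>dball l x.
      indicator (dball n b) y * walsh t y = indicator (dball n b) x * walsh t x" by blast
qed

lemma test_fun_fourier_walsh_eq_0:
  assumes g: "test_fun g" and zero: "\<And>\<xi>. fourier_walsh g \<xi> = 0"
  shows "g x = 0"
proof -
  obtain m n where m: "\<And>x. x \<notin> dball m 0 \<Longrightarrow> g x = 0" and n: "\<And>x y. y \<in> dball n x \<Longrightarrow> g y = g x"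
    and int: "integrable haar g"
    using g unfolding test_fun_def by blast
  have int': "integrable haar (\<lambda>y. indicator (dball l x) y * (g y * walsh \<xi> y))" for l x \<xi>
    using integrable_mult_indicator[OF _ integrable_mult_walsh[OF int], of "dball l x" \<xi>]
    by (simp add: sets_haar scaleR_conv_of_real of_real_indicator)
  \<comment> \<open>The claim must cover all \<xi> at once: halving a ball brings in another
    character and shifts \<xi> by a unit.\<close>
  have small: "(\<integral>y. indicator (dball l x) y * (g y * walsh \<xi> y) \<partial>haar) = 0" if "m \<le> l" for l x \<xi>
    using that
  proof (induction l arbitrary: \<xi> rule: int_ge_induct)
    case base
    show ?case
    \<comment> \<open>Either the ball is the one carrying the support, and the integral is a value
      of the transform, or it misses the support.\<close>
    proof (cases "x \<in> dball m 0")
      case True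
      then have "(\<lambda>y. indicator (dball m x) y * (g y * walsh \<xi> y)) = (\<lambda>y. g y * walsh \<xi> y)"
        using m dball_eqI[of x m 0] by (auto simp: indicator_def fun_eq_iff)
      then show ?thesis using zero[of \<xi>] by (simp only: fourier_walsh_def)
    next
      case False
      have "y \<in> dball m x \<Longrightarrow> y \<notin> dball m 0" for y using False by (auto simp: dball_iff)
      then have "(\<lambda>y. indicator (dball m x) y * (g y * walsh \<xi> y)) = (\<lambda>y. 0)"
        using m by (auto simp: indicator_def fun_eq_iff)
      then show ?thesis by simp
    qed
  next
    case (step l)
    \<comment> \<open>The indicator of half a ball is that of the ball times \<open>(1 + c w) / 2\<close> for a character \<open>w\<close>.\<close>
    define c where "c = walsh (dyadic_unit (- l - 1)) x"
    have "indicator (dball (l + 1) x) y * (g y * walsh \<xi> y) =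
      (1 / 2) * (indicator (dball l x) y * (g y * walsh \<xi> y)) +
      (c / 2) * (indicator (dball l x) y * (g y * walsh (\<xi> + dyadic_unit (- l - 1)) y))" for y
    proof -
      have "k < l + 1 \<longleftrightarrow> k < l \<or> k = l" for k by linarith
      then have "y \<in> dball (l + 1) x \<longleftrightarrow> y \<in> dball l x \<and> coord y l = coord x l"
        by (auto simp: dball_iff)
      then show ?thesis
        using bit_eq_0_or_1[of "coord x l"] bit_eq_0_or_1[of "coord y l"]
        by (auto simp: indicator_def c_def walsh_add_left walsh_dyadic_unit field_simps)
    qed
    then show ?case using step.IH int' by simp
  qed
  \<comment> \<open>At this index \<open>small\<close> applies and g is constant on the ball, so
    \<xi> = 0 leaves the mass of the ball times \<open>g x\<close>.\<close>
  let ?N = "max m n"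
  have "(\<lambda>y. indicator (dball ?N x) y * (g y * walsh 0 y)) = (\<lambda>y. indicator (dball ?N x) y * g x)"
  proof
    fix y
    show "indicator (dball ?N x) y * (g y * walsh 0 y) = indicator (dball ?N x) y * g x"
    proof (cases "y \<in> dball ?N x")
      case True
      then have "g y = g x" using dball_antimono[of n ?N x] by (intro n) auto
      then show ?thesis by simp
    qed simp
  qed
  then have "(\<integral>y. indicator (dball ?N x) y * g x \<partial>haar) = 0"
    using small[of ?N x 0] by (simp only: max.cobounded1)
  moreover have "(\<integral>y. indicator (dball ?N x) y * g x \<partial>haar) = of_real (2 powi (- ?N)) * g x"
  proof -
    have "(\<integral>y. (indicator (dball ?N x) y :: complex) \<partial>haar) =
        of_real (\<integral>y. indicator (dball ?N x) y \<partial>haar)"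
      using integral_complex_of_real[of haar "indicator (dball ?N x)"]
      by (simp only: of_real_indicator)
    also have "\<dots> = of_real (2 powi (- ?N))"
      by (simp add: measure_def emeasure_haar_dball sets_eq_imp_space_eq[OF sets_haar])
    finally show ?thesis by simp
  qed
  ultimately have "complex_of_real (2 powi (- ?N)) * g x = 0" by (simp only:)
  moreover have "complex_of_real (2 powi (- ?N)) \<noteq> 0"
    by (simp only: of_real_eq_0_iff power_int_eq_0_iff zero_neq_numeral[symmetric] simp_thms)
  ultimately show ?thesis by (simp only: mult_eq_0_iff simp_thms)
qed

section \<open>Haar functions\<close>

text \<open>The two dilates are the indicators of the halves of the unit ball on which digit 0 is 0
  or 1. Their difference is a sign given by that digit, and the factors 2^{1/2} and 2^{-1/2}
  cancel.\<close>

lemma haar_wavelet_eq: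
  "haar_wavelet x = indicator unit_ball x * walsh (dyadic_unit (- 1)) x"
proof -
  \<comment> \<open>Dilation turns conditions at k < 0 into conditions on digits up to 0; this
    splits off digit 0.\<close>
  have lt: "(\<forall>k<0. P k) \<longleftrightarrow> (\<forall>k<0. P (k - 1)) \<and> P (- 1)" for P :: "int \<Rightarrow> bool"
  proof -
    have "k = - 1 \<or> k + 1 < 0" if "k < 0" for k :: int using that by linarith
    then show ?thesis by (metis diff_add_cancel add.commute diff_less_eq less_add_one less_trans
          neg_less_0_iff_less zero_less_one add_diff_cancel)
  qed
  have 0: "dilation_pow 1 x \<in> unit_ball \<longleftrightarrow> x \<in> unit_ball \<and> coord x 0 = 0"
    by (subst dball_iff, subst lt) (simp add: coord_dilation_pow dball_iff)
  have 1: "dilation_pow 1 x + dyadic_unit (- 1) \<in> unit_ball \<longleftrightarrow> x \<in> unit_ball \<and> coord x 0 = 1"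
  proof -
    have "a + 1 = 0 \<longleftrightarrow> a = 1" for a :: bit by (cases a) auto
    then show ?thesis by (subst dball_iff, subst lt) (auto simp: coord_dilation_pow dball_iff)
  qed
  have "complex_of_real (2 powr (- 1 / 2)) * complex_of_real (2 powr (1 / 2)) = 1"
    by (simp flip: of_real_mult powr_add)
  then have "complex_of_real (2 powr (- 1 / 2)) * (complex_of_real (2 powr (1 / 2)) * z) = z" for z
    by (metis mult.assoc mult_1)
  then have "haar_wavelet x = scaling_fun (dilation_pow 1 x) - scaling_fun (dilation_pow 1 x + dyadic_unit (- 1))"
    unfolding haar_wavelet_def dilate_translate_def lam_inv_0 lam_inv_1 of_int_1 add_0_right
      right_diff_distrib[symmetric] .
  then show ?thesis
    using bit_eq_0_or_1[of "coord x 0"]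
    by (auto simp: scaling_fun_def indicator_def 0 1 walsh_dyadic_unit)
qed

text \<open>Dilation moves the digit read by the character from 0 to j. By multiplicativity the
  shift h enters only through the centre of the ball and a constant sign, so
  \<open>lam_inv (real k)\<close> is never computed.\<close>

lemma haar_fun_eq:
  obtains c b where "c \<noteq> 0"
    "haar_fun j k = (\<lambda>x. c * (indicator (dball j b) x * walsh (dyadic_unit (- j - 1)) x))"
proof
  define h where "h = lam_inv (real k)"
  \<comment> \<open>The point whose dilation is h, so that the argument of the wavelet vanishes
    there.\<close>
  define b where "b = dilation_pow (- j) h"
  define c where "c = complex_of_real (2 powr (of_int j / 2)) * walsh (dyadic_unit (- 1)) h"
  have "walsh (dyadic_unit (- 1)) h \<noteq> 0" by (metis norm_walsh norm_zero zero_neq_one)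
  then show "c \<noteq> 0" by (simp add: c_def)
  show "haar_fun j k = (\<lambda>x. c * (indicator (dball j b) x * walsh (dyadic_unit (- j - 1)) x))"
  proof
    fix x
    have add0: "u + v = 0 \<longleftrightarrow> u = v" for u v :: bit by (cases u; cases v) auto
    have "dilation_pow j x + h \<in> unit_ball \<longleftrightarrow> (\<forall>i<0. coord x (i + j) = coord h i)"
      by (simp only: dball_iff coord_plus coord_zero coord_dilation_pow add0)
    also have "\<dots> \<longleftrightarrow> x \<in> dball j b"
      by (simp add: dball_iff b_def coord_dilation_pow)
         (metis add_less_same_cancel2 diff_add_cancel diff_less_0_iff_less add_diff_cancel)
    finally have ball: "indicator unit_ball (dilation_pow j x + h) = (indicator (dball j b) x :: complex)"
      by (simp add: indicator_def)
    have "walsh (dyadic_unit (- 1)) (dilation_pow j x) = walsh (dyadic_unit (- j - 1)) x"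
      by (simp add: walsh_dyadic_unit coord_dilation_pow)
    then show "haar_fun j k x = c * (indicator (dball j b) x * walsh (dyadic_unit (- j - 1)) x)"
      by (simp add: haar_fun_def dilate_translate_def haar_wavelet_eq walsh_add_right
          ball c_def flip: h_def)
  qed
qed

lemma test_fun_haar_fun: "test_fun (haar_fun j k)"
proof -
  obtain c b where "haar_fun j k = (\<lambda>x. c * (indicator (dball j b) x * walsh (dyadic_unit (- j - 1)) x))"
    by (rule haar_fun_eq)
  then show ?thesis by (simp add: test_fun_cmult test_fun_indicator_walsh)
qed

lemma test_fun_haar_polys: "g \<in> haar_polys \<Longrightarrow> test_fun g"
  unfolding haar_polys_def
  by (auto simp: case_prod_beta intro!: test_fun_sum test_fun_cmult test_fun_haar_fun)

text \<open>Supplies the uniqueness behind the description operator in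
  \<open>gibbs_derivative\<close>: the difference is a test function with vanishing
  transform.\<close>

lemma haar_polys_eqI:
  assumes f: "f \<in> haar_polys" and g: "g \<in> haar_polys"
    and eq: "\<And>\<xi>. fourier_walsh f \<xi> = fourier_walsh g \<xi>"
  shows "f = g"
proof
  fix x
  have t: "test_fun f" "test_fun g" using f g test_fun_haar_polys by auto
  have "test_fun (\<lambda>x. f x + (- 1) * g x)" by (intro test_fun_add test_fun_cmult t)
  then have t': "test_fun (\<lambda>x. f x - g x)" by simp
  have "integrable haar f" "integrable haar g" using t by (auto simp: test_fun_def)
  then have "fourier_walsh (\<lambda>x. f x - g x) \<xi> = 0" for \<xi>
    using eq[of \<xi>] by (simp add: fourier_walsh_def left_diff_distrib integrable_mult_walsh)
  then have "f x - g x = 0" using test_fun_fourier_walsh_eq_0[OF t'] by blast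
  then show "f x = g x" by simp
qed

section \<open>Spectral support of the Haar functions and the eigenvalue\<close>

lemma cmult_haar_fun_in_haar_polys: "(\<lambda>x. c * haar_fun j k x) \<in> haar_polys"
  unfolding haar_polys_def
  by (intro CollectI exI[of _ "{(j, k)}"] exI[of _ "\<lambda>_ _. c"]) simp

text \<open>The transform at \<xi> is a multiple of the integral of the character of
  \<open>dyadic_unit (- j - 1) + \<xi>\<close> over a ball of index j. If it is nonzero, this sum
  has no digit 1 below -j, so \<xi> agrees with the unit there and has leading index -j-1.\<close>

lemma fourier_walsh_haar_fun_nonzeroD:
  assumes "fourier_walsh (haar_fun j k) \<xi> \<noteq> 0"
  shows "norm_dyadic \<xi> = 2 powi j"
proof -
  obtain c b where *: "haar_fun j k = (\<lambda>x. c * (indicator (dball j b) x * walsh (dyadic_unit (- j - 1)) x))"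
    by (rule haar_fun_eq)
  have "fourier_walsh (haar_fun j k) \<xi> =
      c * (\<integral>x. indicator (dball j b) x * walsh (dyadic_unit (- j - 1) + \<xi>) x \<partial>haar)"
    by (simp add: fourier_walsh_def * walsh_add_left mult.assoc)
  with assms have "(\<integral>x. indicator (dball j b) x * walsh (dyadic_unit (- j - 1) + \<xi>) x \<partial>haar) \<noteq> 0"
    by auto
  then have "coord (dyadic_unit (- j - 1) + \<xi>) i \<noteq> 1" if "i < - j" for i
    using integral_walsh_dball_eq_0 that by blast
  then have z: "coord (dyadic_unit (- j - 1) + \<xi>) i = 0" if "i < - j" for i
    using bit_eq_0_or_1 that by blast
  have one: "coord \<xi> (- j - 1) = 1"
    using z[of "- j - 1"] by (cases "coord \<xi> (- j - 1)") auto
  have below: "coord \<xi> i = 0" if "i < - j - 1" for i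
    using z[of i] that by simp
  have "leading_index \<xi> = - j - 1"
    unfolding leading_index_def
    by (rule Least_equality) (use one below in \<open>force simp: not_less[symmetric]\<close>)+
  moreover have "\<xi> \<noteq> 0" using one by auto
  ultimately show ?thesis by (simp add: norm_dyadic_def)
qed

theorem corollary2:
  fixes \<alpha> :: real and j :: int and k :: nat
  shows "eigenfunction (gibbs_derivative \<alpha>) (complex_of_real (2 powr (of_int j * \<alpha>))) (haar_fun j k)"
proof -
  let ?c = "complex_of_real (2 powr (of_int j * \<alpha>))"
  have symbol: "fourier_walsh (\<lambda>x. ?c * haar_fun j k x) \<xi> =
      complex_of_real (gibbs_symbol \<alpha> \<xi>) * fourier_walsh (haar_fun j k) \<xi>" for \<xi>
  proof (cases "fourier_walsh (haar_fun j k) \<xi> = 0")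
    case False
    then have norm: "norm_dyadic \<xi> = 2 powi j" by (rule fourier_walsh_haar_fun_nonzeroD)
    \<comment> \<open>The conventional value 1 of the symbol at 0 is thus never met: the transform
      vanishes there.\<close>
    then have "\<xi> \<noteq> 0" by (auto simp: norm_dyadic_def)
    moreover have "norm_dyadic \<xi> powr \<alpha> = 2 powr (of_int j * \<alpha>)"
      by (simp add: norm powr_powr flip: powr_real_of_int')
    ultimately show ?thesis by (simp add: fourier_walsh_def gibbs_symbol_def mult.assoc)
  qed (simp add: fourier_walsh_def mult.assoc)
  have "gibbs_derivative \<alpha> (haar_fun j k) = (\<lambda>x. ?c * haar_fun j k x)"
    unfolding gibbs_derivative_def
  proof (rule the_equality)
    show "(\<lambda>x. ?c * haar_fun j k x) \<in> haar_polys \<and> (\<forall>\<xi>. fourier_walsh (\<lambda>x. ?c * haar_fun j k x) \<xi> =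
        complex_of_real (gibbs_symbol \<alpha> \<xi>) * fourier_walsh (haar_fun j k) \<xi>)"
      using cmult_haar_fun_in_haar_polys symbol by blast
  next
    fix g
    assume "g \<in> haar_polys \<and> (\<forall>\<xi>. fourier_walsh g \<xi> =
        complex_of_real (gibbs_symbol \<alpha> \<xi>) * fourier_walsh (haar_fun j k) \<xi>)"
    then show "g = (\<lambda>x. ?c * haar_fun j k x)"
      by (intro haar_polys_eqI cmult_haar_fun_in_haar_polys) (auto simp: symbol)
  qed
  moreover have "haar_fun j k \<in> haar_polys"
    using cmult_haar_fun_in_haar_polys[of 1] by simp
  moreover have "haar_fun j k \<noteq> (\<lambda>_. 0)"
  proof -
    obtain c b where c: "c \<noteq> 0"
      and *: "haar_fun j k = (\<lambda>x. c * (indicator (dball j b) x * walsh (dyadic_unit (- j - 1)) x))"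
      by (rule haar_fun_eq)
    \<comment> \<open>At the centre b the indicator is 1 and the character has modulus 1.\<close>
    have "walsh (dyadic_unit (- j - 1)) b \<noteq> 0" by (metis norm_walsh norm_zero zero_neq_one)
    then have "haar_fun j k b \<noteq> 0" using c by (simp add: *)
    then show ?thesis by auto
  qed
  ultimately show ?thesis by (simp add: eigenfunction_def)
qed

end
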